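(* Let $\Delta=(\mathfrak{D}_1,\dots,\mathfrak{D}_d)$ be a system of delta operators on $\mathbb{R}[x_1,\dots,x_d]$ and let $Z=\{z_{\mathbf{k}}:\mathbf{k}\in\mathbb{N}^d\}\subseteq\mathbb{R}^d$ be a grid. Then the associated sequence of delta Gončarov polynomials $\{t_{\mathbf{n}}(\mathbf{x};Z)\}_{\mathbf{n}\in\mathbb{N}^d}$ is of binomial type if and only if there is a real $d\times d$ matrix $A$ such that $z_{\mathbf{k}}=A\mathbf{k}$ for all $\mathbf{k}\in\mathbb{N}^d$ (viewing $\mathbf{k}$ as a column vector).
   Context: Shift-invariant operators on $\mathbb{R}[\mathbf{x}]$ commute with all shifts $f(\mathbf{x})\mapsto f(\mathbf{x}+\mathbf{v})$; each is uniquely a formal power series in $D_i=\partial/\partial x_i$. A system of delta operators is a $d$-tuple of shift-invariant linear operators such that for every nonzero $p=a_1x_1+\cdots+a_dx_d$ each $\mathfrak{D}_ip$ is a real constant $c_i$ and some $c_i\ne0$. The basic sequence $\{p_{\mathbf{n}}\}$ of $\Delta$ is the unique family with $\deg p_{\mathbf{n}}=|\mathbf{n}|$, $p_{\mathbf{0}}=1$, $p_{\mathbf{n}}(\mathbf{0})=0$ for $|\mathbf{n}|\ge1$, $\mathfrak{D}_ip_{\mathbf{n}}=n_ip_{\mathbf{n}-\mathbf{e}_i}$; $\Pi^d_{\mathbf{n}}(\Delta)=\operatorname{span}\{p_{\mathbf{k}}:\mathbf{k}\le\mathbf{n}\}$ (componentwise order). The delta Gončarov polynomial $t_{\mathbf{n}}(\mathbf{x};Z)$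 is the unique polynomial in $\Pi^d_{\mathbf{n}}(\Delta)$ with $\big[\mathfrak{D}_1^{k_1}\cdots\mathfrak{D}_d^{k_d}t_{\mathbf{n}}\big](z_{\mathbf{k}})=\mathbf{n}!\,\delta_{\mathbf{k},\mathbf{n}}$ for all $\mathbf{k}\le\mathbf{n}$. A family of polynomials $\{q_{\mathbf{n}}\}_{\mathbf{n}\in\mathbb{N}^d}$ with $\deg q_{\mathbf{n}}=|\mathbf{n}|$ is of binomial type if $q_{\mathbf{0}},q_{\mathbf{e}_1},\dots,q_{\mathbf{e}_d}$ span the space of polynomials of degree $\le1$ and $q_{\mathbf{n}}(\mathbf{x}+\mathbf{y})=\sum_{\mathbf{k}\le\mathbf{n}}\binom{\mathbf{n}}{\mathbf{k}}q_{\mathbf{k}}(\mathbf{x})q_{\mathbf{n}-\mathbf{k}}(\mathbf{y})$ for all $\mathbf{n}$, where $\binom{\mathbf{n}}{\mathbf{k}}=\prod_i\binom{n_i}{k_i}$. *)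

theory Defs
  imports "HOL-Analysis.Analysis" "HOL-Library.Function_Algebras"
begin

instantiation "fun" :: (type, real_vector) real_vector
begin

definition scaleR_fun :: "real \<Rightarrow> ('a \<Rightarrow> 'b) \<Rightarrow> 'a \<Rightarrow> 'b" where
  "scaleR_fun c f = (\<lambda>x. c *\<^sub>R f x)"

instance
  by standard (auto simp: scaleR_fun_def fun_eq_iff algebra_simps)

end

text \<open>
  The ring \<open>\<real>[x\<^sub>1,\<dots>,x\<^sub>d]\<close> is represented by the polynomial functions on \<open>real ^ 'd\<close>; as the field
  is infinite, polynomials and polynomial functions are in bijection.  The index type \<open>'d\<close> plays
  the role of \<open>{1,\<dots>,d}\<close> with its usual order, and a multi-index is an element of \<open>nat ^ 'd\<close>, where
  the order \<open>\<le>\<close> and the operations \<open>+\<close>, \<open>-\<close> are componentwise and \<open>axis i 1\<close> is the \<open>i\<close>-th unit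
  multi-index.
\<close>

abbreviation polys :: "(real ^ 'd \<Rightarrow> real) set" where
  "polys \<equiv> Collect real_polynomial_function"

definition mi_size :: "nat ^ 'd::finite \<Rightarrow> nat" where
  "mi_size k = (\<Sum>i\<in>UNIV. k $ i)"

definition mi_fact :: "nat ^ 'd::finite \<Rightarrow> real" where
  "mi_fact n = (\<Prod>i\<in>UNIV. fact (n $ i))"

definition mi_choose :: "nat ^ 'd::finite \<Rightarrow> nat ^ 'd \<Rightarrow> nat" where
  "mi_choose n k = (\<Prod>i\<in>UNIV. (n $ i) choose (k $ i))"

definition monomial :: "nat ^ 'd::finite \<Rightarrow> real ^ 'd \<Rightarrow> real" where
  "monomial k = (\<lambda>x. \<Prod>i\<in>UNIV. (x $ i) ^ (k $ i))"

text \<open>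
  The total degree of a nonzero polynomial; the zero polynomial has no degree (for \<open>m = 0\<close> the
  second span is \<open>{0}\<close>).
\<close>

definition has_degree :: "(real ^ 'd::finite \<Rightarrow> real) \<Rightarrow> nat \<Rightarrow> bool" where
  "has_degree f m \<longleftrightarrow>
     f \<in> span (monomial ` {k. mi_size k \<le> m}) \<and> f \<notin> span (monomial ` {k. mi_size k < m})"

text \<open>
  Operators are total on functions, but only their restriction to \<open>polys\<close> is meaningful.
\<close>

definition shift_invariant_op ::
    "((real ^ 'd::finite \<Rightarrow> real) \<Rightarrow> (real ^ 'd \<Rightarrow> real)) \<Rightarrow> bool" where
  "shift_invariant_op T \<longleftrightarrow>
     (\<forall>f\<in>polys. T f \<in> polys) \<and>
     (\<forall>f\<in>polys. \<forall>g\<in>polys. T (f + g) = T f + T g) \<and>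
     (\<forall>c. \<forall>f\<in>polys. T (c *\<^sub>R f) = c *\<^sub>R T f) \<and>
     (\<forall>v. \<forall>f\<in>polys. T (\<lambda>x. f (x + v)) = (\<lambda>x. T f (x + v)))"

definition delta_system ::
    "('d::finite \<Rightarrow> (real ^ 'd \<Rightarrow> real) \<Rightarrow> (real ^ 'd \<Rightarrow> real)) \<Rightarrow> bool" where
  "delta_system D \<longleftrightarrow>
     (\<forall>i. shift_invariant_op (D i)) \<and>
     (\<forall>a :: real ^ 'd. a \<noteq> 0 \<longrightarrow>
        (\<exists>c. (\<forall>i. D i (\<lambda>x. \<Sum>j\<in>UNIV. a $ j * x $ j) = (\<lambda>x. c i)) \<and> (\<exists>i. c i \<noteq> 0)))"

text \<open>
  If \<open>n $ i = 0\<close>, then \<open>n - axis i 1 = n\<close> by truncated subtraction, but the coefficient \<open>n $ i\<close>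
  vanishes.
\<close>

definition is_basic_sequence ::
    "('d::finite \<Rightarrow> (real ^ 'd \<Rightarrow> real) \<Rightarrow> (real ^ 'd \<Rightarrow> real)) \<Rightarrow>
     (nat ^ 'd \<Rightarrow> real ^ 'd \<Rightarrow> real) \<Rightarrow> bool" where
  "is_basic_sequence D p \<longleftrightarrow>
     (\<forall>n. has_degree (p n) (mi_size n)) \<and>
     p 0 = (\<lambda>x. 1) \<and>
     (\<forall>n. mi_size n \<ge> 1 \<longrightarrow> p n 0 = 0) \<and>
     (\<forall>i n. D i (p n) = real (n $ i) *\<^sub>R p (n - axis i 1))"

definition basic_sequence ::
    "('d::finite \<Rightarrow> (real ^ 'd \<Rightarrow> real) \<Rightarrow> (real ^ 'd \<Rightarrow> real)) \<Rightarrow>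
     nat ^ 'd \<Rightarrow> real ^ 'd \<Rightarrow> real" where
  "basic_sequence D = (THE p. is_basic_sequence D p)"

definition delta_space ::
    "('d::finite \<Rightarrow> (real ^ 'd \<Rightarrow> real) \<Rightarrow> (real ^ 'd \<Rightarrow> real)) \<Rightarrow> nat ^ 'd \<Rightarrow>
     (real ^ 'd \<Rightarrow> real) set" where
  "delta_space D n = span (basic_sequence D ` {k. k \<le> n})"

text \<open>
  For \<open>'d = {1 < \<dots> < d}\<close> the following is the composition of \<open>D 1 ^^ (k $ 1)\<close>, \<open>\<dots>\<close>,
  \<open>D d ^^ (k $ d)\<close> in this order.
\<close>

definition delta_power ::
    "('d::{finite,linorder} \<Rightarrow> ((real, 'd) vec \<Rightarrow> real) \<Rightarrow> ((real, 'd) vec \<Rightarrow> real)) \<Rightarrow> (nat, 'd) vec \<Rightarrow>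
     ((real, 'd) vec \<Rightarrow> real) \<Rightarrow> ((real, 'd) vec \<Rightarrow> real)" where
  "delta_power D k = foldr (\<lambda>i T. (D i ^^ (k $ i)) \<circ> T) (sorted_list_of_set UNIV) id"

definition delta_goncarov ::
    "('d::{finite,linorder} \<Rightarrow> ((real, 'd) vec \<Rightarrow> real) \<Rightarrow> ((real, 'd) vec \<Rightarrow> real)) \<Rightarrow>
     ((nat, 'd) vec \<Rightarrow> (real, 'd) vec) \<Rightarrow> (nat, 'd) vec \<Rightarrow> (real, 'd) vec \<Rightarrow> real" where
  "delta_goncarov D z n =
     (THE t. t \<in> delta_space D n \<and>
        (\<forall>k\<le>n. delta_power D k t (z k) = (if k = n then mi_fact n else 0)))"

definition binomial_type :: "(nat ^ 'd::finite \<Rightarrow> real ^ 'd \<Rightarrow> real) \<Rightarrow> bool" where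
  "binomial_type q \<longleftrightarrow>
     (\<forall>n. has_degree (q n) (mi_size n)) \<and>
     span (insert (q 0) (range (\<lambda>i. q (axis i 1)))) = span (monomial ` {k. mi_size k \<le> 1}) \<and>
     (\<forall>n x y. q n (x + y) = (\<Sum>k | k \<le> n. real (mi_choose n k) * q k x * q (n - k) y))"

text \<open>
  The index sets of the sums above are finite, and the polynomial functions are exactly the linear
  combinations of monomials.
\<close>

lemma finite_mi_le: "finite {k :: nat ^ 'd::finite. k \<le> n}"
proof -
  have "{k. k \<le> n} \<subseteq> vec_lambda ` (UNIV \<rightarrow>\<^sub>E {..Max (range (($) n))})"
  proof
    fix k assume "k \<in> {k. k \<le> n}"
    then have "k $ i \<le> Max (range (($) n))" for i
      by (auto simp: less_eq_vec_def intro: order.trans[OF _ Max_ge])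
    then have "($) k \<in> UNIV \<rightarrow>\<^sub>E {..Max (range (($) n))}"
      by auto
    then show "k \<in> vec_lambda ` (UNIV \<rightarrow>\<^sub>E {..Max (range (($) n))})"
      by (metis imageI vec_nth_inverse)
  qed
  then show ?thesis
    by (rule finite_subset) (intro finite_imageI finite_PiE, auto)
qed

lemma sum_fun_apply: "(\<Sum>i\<in>S. f i) x = (\<Sum>i\<in>S. f i x)"
  for f :: "'b \<Rightarrow> 'a \<Rightarrow> 'c::comm_monoid_add"
  by (induction S rule: infinite_finite_induct) auto

lemma monomial_mult: "monomial k x * monomial l x = monomial (k + l) x"
  by (simp add: monomial_def power_add prod.distrib)

lemma monomial_in_polys: "(monomial k :: real ^ 'd::finite \<Rightarrow> real) \<in> polys"
proof -
  have coord: "real_polynomial_function (\<lambda>x :: real ^ 'd. x $ i)" for i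
    by (intro real_polynomial_function.intros(1) bounded_linear_vec_nth)
  have "real_polynomial_function (\<lambda>x :: real ^ 'd. \<Prod>i\<in>S. (x $ i) ^ (k $ i))" if "finite S" for S
    using that
    by induction (auto intro!: real_polynomial_function_power coord)
  then show ?thesis
    by (simp add: monomial_def)
qed

lemma polys_eq_span_monomials: "polys = span (range (monomial :: nat ^ 'd::finite \<Rightarrow> _))"
proof
  have sub: "subspace (polys :: (real ^ 'd \<Rightarrow> real) set)"
    by (auto simp: subspace_def plus_fun_def zero_fun_def scaleR_fun_def)
  show "span (range monomial) \<subseteq> (polys :: (real ^ 'd \<Rightarrow> real) set)"
    by (rule span_minimal[OF _ sub]) (use monomial_in_polys in auto)
next
  let ?S = "span (range (monomial :: nat ^ 'd \<Rightarrow> _))"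
  have mono_mult: "monomial k * g \<in> ?S" if "g \<in> ?S" for k g
    using that
  proof (induction rule: span_induct_alt)
    case base
    show ?case
      by (metis (no_types, lifting) mult_zero_left mult_zero_right span_zero)
  next
    case (step c f g)
    then obtain l where f: "f = monomial l" by auto
    have "monomial k * (c *\<^sub>R f + g) = c *\<^sub>R monomial (k + l) + monomial k * g"
      by (auto simp: fun_eq_iff scaleR_fun_def f algebra_simps simp flip: monomial_mult)
    moreover have "monomial k * g \<in> ?S"
      using step by (simp add: times_fun_def)
    ultimately have "monomial k * (c *\<^sub>R f + g) \<in> ?S"
      by (simp add: span_add span_scale span_base)
    then show ?case
      by (simp only: times_fun_def)
  qed
  have mult: "f * g \<in> ?S" if "f \<in> ?S" "g \<in> ?S" for f g
    using that(1)
  proof (induction rule: span_induct_alt)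
    case base
    show ?case
      by (metis (no_types, lifting) mult_zero_left mult_zero_right span_zero)
  next
    case (step c h f)
    then obtain l where h: "h = monomial l" by auto
    have "(c *\<^sub>R h + f) * g = c *\<^sub>R (monomial l * g) + f * g"
      by (auto simp: fun_eq_iff scaleR_fun_def h algebra_simps)
    moreover have "f * g \<in> ?S"
      using step by (simp add: times_fun_def)
    ultimately have "(c *\<^sub>R h + f) * g \<in> ?S"
      by (simp add: span_add span_scale mono_mult[OF that(2)])
    then show ?case
      by (simp only: times_fun_def)
  qed
  have coord: "(\<lambda>x. x $ i) = (monomial (axis i 1) :: real ^ 'd \<Rightarrow> real)" for i
  proof
    fix x :: "real ^ 'd"
    have "monomial (axis i 1) x = (\<Prod>j\<in>UNIV. if j = i then x $ j else 1)"
      unfolding monomial_def by (intro prod.cong) (auto simp: axis_def)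
    then show "x $ i = monomial (axis i 1) x" by simp
  qed
  have one: "(\<lambda>x. 1) = (monomial 0 :: real ^ 'd \<Rightarrow> real)"
    by (simp add: monomial_def)
  show "polys \<subseteq> ?S"
  proof
    fix f :: "real ^ 'd \<Rightarrow> real" assume "f \<in> polys"
    then have "real_polynomial_function f" by simp
    then show "f \<in> ?S"
    proof induction
      case (linear f)
      then have lin: "linear f" by (rule bounded_linear.linear)
      let ?g = "\<Sum>i\<in>UNIV. f (axis i 1) *\<^sub>R monomial (axis i 1)"
      have "f x = ?g x" for x
      proof -
        have "f x = f (\<Sum>i\<in>UNIV. x $ i *\<^sub>R axis i 1)"
          by (simp add: basis_expansion flip: scalar_mult_eq_scaleR)
        also have "\<dots> = (\<Sum>i\<in>UNIV. x $ i * f (axis i 1))"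
          by (simp add: linear_sum[OF lin] linear_cmul[OF lin])
        also have "\<dots> = ?g x"
          by (simp only: sum_fun_apply scaleR_fun_def coord[THEN fun_cong, symmetric] real_scaleR_def mult.commute)
        finally show ?thesis .
      qed
      then have "f = ?g" by (rule ext)
      moreover have "?g \<in> ?S"
        by (intro span_sum span_scale span_base rangeI)
      ultimately show ?case by (rule ssubst[where P = "\<lambda>g. g \<in> ?S"])
    next
      case (const c)
      have "c *\<^sub>R monomial 0 \<in> ?S"
        by (intro span_scale span_base rangeI)
      moreover have "(\<lambda>x. c) = c *\<^sub>R (monomial 0 :: real ^ 'd \<Rightarrow> real)"
        by (simp add: scaleR_fun_def flip: one)
      ultimately show ?case by simp
    next
      case (add f g)
      then show ?case
        using span_add[of f _ g] by (simp add: plus_fun_def)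
    next
      case (mult f g)
      then show ?case
        using \<open>\<And>f g. f \<in> ?S \<Longrightarrow> g \<in> ?S \<Longrightarrow> f * g \<in> ?S\<close>[of f g] by (simp add: times_fun_def)
    qed
  qed
qed

end

theory Submission
  imports Defs
begin

text \<open>
  Write \<open>D\<^sup>k\<close> for \<open>delta_power D k\<close> and \<open>E\<^sub>v\<close> for the shift by \<open>v\<close>.  A polynomial \<open>f\<close> with
  \<open>(D\<^sup>k f) (z k) = 0\<close> for all \<open>k\<close> vanishes: by induction on the degree every \<open>D i f\<close> vanishes, so \<open>f\<close>
  is constant.  Hence \<open>t\<^sub>n\<close> is determined by \<open>(D\<^sup>k t\<^sub>n) (z k) = n! \<delta>\<^sub>k\<^sub>n\<close> for \<^emph>\<open>all\<close> \<open>k\<close>, exists since the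
  linear system for its coefficients is square, and for \<open>z = 0\<close> is the basic sequence.

  The sequence is binomial if and only if \<open>E\<^bsub>z k\<^esub> D\<^sup>k t\<^sub>n = n! / (n - k)! t\<^bsub>n - k\<^esub>\<close> for all \<open>k \<le> n\<close>.  If so,
  then \<open>E\<^bsub>z k + z l\<^esub> D\<^bsup>k + l\<^esup>\<close> and \<open>E\<^bsub>z (k + l)\<^esub> D\<^bsup>k + l\<^esup>\<close> agree on \<open>t\<^sub>n\<close>; for \<open>n = k + l + e\<^sub>i\<close> this says that
  the \<open>t\<close> with index \<open>e\<^sub>i\<close>, which separate points, do not distinguish \<open>z k + z l - z (k + l)\<close> from \<open>0\<close>.
  Conversely, if \<open>z\<close> is additive then \<open>D\<^sup>k t\<^sub>n\<close> is a multiple of the polynomial of index \<open>n - k\<close> for the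
  grid \<open>l \<mapsto> z l + z k\<close>, and shifting moves that grid back to \<open>z\<close>.
\<close>

subsection \<open>Multi-indices\<close>

lemma mi_size_add: "mi_size (k + l) = mi_size k + mi_size l"
  by (simp add: mi_size_def sum.distrib)

lemma mi_size_mono: "k \<le> n \<Longrightarrow> mi_size k \<le> mi_size n"
  by (auto simp: mi_size_def less_eq_vec_def intro: sum_mono)

lemma mi_size_eq_0_iff: "mi_size k = 0 \<longleftrightarrow> k = 0"
  by (simp add: mi_size_def vec_eq_iff)

lemma mi_size_0 [simp]: "mi_size 0 = 0"
  by (simp add: mi_size_eq_0_iff)

lemma mi_size_axis: "mi_size (axis i 1) = 1"
  by (simp add: mi_size_def axis_def)

declare mi_size_axis [simplified, simp]

lemma mi_le_add: "k \<le> k + (l :: nat ^ 'd::finite)"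
  by (simp add: less_eq_vec_def)

lemma mi_le_minus: "n - k \<le> (n :: nat ^ 'd::finite)"
  by (simp add: less_eq_vec_def)

lemma mi_add_diff: "k \<le> n \<Longrightarrow> k + (n - k) = (n :: nat ^ 'd::finite)"
  by (simp add: less_eq_vec_def vec_eq_iff)

lemma mi_diff_diff: "k \<le> n \<Longrightarrow> n - (n - k) = (k :: nat ^ 'd::finite)"
  by (simp add: less_eq_vec_def vec_eq_iff)

lemma mi_add_diff_left: "k + l - k = (l :: nat ^ 'd::finite)"
  by (simp add: vec_eq_iff)

lemma mi_size_diff: "k \<le> n \<Longrightarrow> mi_size (n - k) = mi_size n - mi_size k"
  by (metis mi_add_diff mi_size_add add_diff_cancel_left')

lemma finite_mi_size_less: "finite {k :: nat ^ 'd::finite. mi_size k < m}"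
proof (rule finite_subset)
  have "k $ i \<le> mi_size k" for k :: "nat ^ 'd" and i
    by (simp add: mi_size_def member_le_sum)
  then show "{k :: nat ^ 'd. mi_size k < m} \<subseteq> {k. k \<le> (\<chi> i. m)}"
    by (auto simp: less_eq_vec_def) (meson le_less_trans less_imp_le)
qed (rule finite_mi_le)

lemma mi_size_1_iff: "mi_size k = 1 \<longleftrightarrow> (\<exists>i. k = axis i 1)"
proof
  assume *: "mi_size k = 1"
  then obtain i where "k $ i \<noteq> 0"
    by (metis mi_size_def sum.neutral zero_neq_one)
  then have "axis i 1 \<le> k"
    by (auto simp: less_eq_vec_def axis_def)
  moreover from this have "mi_size (k - axis i 1) = 0"
    by (simp add: mi_size_diff *)
  ultimately show "\<exists>i. k = axis i 1"
    by (metis mi_add_diff add.right_neutral mi_size_eq_0_iff)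
qed auto

lemma mi_fact_pos: "mi_fact n > 0"
  by (simp add: mi_fact_def prod_pos)

lemma mi_fact_nonzero [simp]: "mi_fact n \<noteq> 0"
  using mi_fact_pos[of n] by simp

lemma mi_choose_fact:
  assumes "k \<le> n"
  shows "real (mi_choose n k) * mi_fact k * mi_fact (n - k) = mi_fact n"
  using assms
  by (simp add: mi_choose_def mi_fact_def less_eq_vec_def binomial_fact flip: prod.distrib)

lemma mi_choose_symmetric: "k \<le> n \<Longrightarrow> mi_choose n (n - k) = mi_choose n k"
  by (auto simp: mi_choose_def less_eq_vec_def binomial_symmetric[symmetric] intro!: prod.cong)

lemma mi_fact_axis_add: "mi_fact (k + axis i 1) = real (k $ i + 1) * mi_fact k"
proof -
  have "mi_fact (k + axis i 1) = (\<Prod>j\<in>UNIV. (if j = i then real (k $ i + 1) else 1) * fact (k $ j))"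
    unfolding mi_fact_def by (intro prod.cong) (auto simp: axis_def)
  then show ?thesis
    by (simp add: prod.distrib mi_fact_def)
qed

lemma sum_mi_reflect:
  fixes n :: "nat ^ 'd::finite"
  shows "(\<Sum>k | k \<le> n. f (n - k)) = (\<Sum>k | k \<le> n. f k)"
  by (rule sum.reindex_bij_witness[of _ "\<lambda>k. n - k" "\<lambda>k. n - k"])
     (auto simp: mi_diff_diff mi_le_minus)

text \<open>A nonzero multi-index has a positive coordinate, from which a unit can be removed. This
  induction lifts facts about a single \<open>D i\<close> to \<open>delta_power D k\<close>.\<close>

lemma mi_induct [case_names zero add]:
  assumes "P 0" "\<And>k i. P k \<Longrightarrow> P (k + axis i 1)"
  shows "P (k :: nat ^ 'd::finite)"
proof (induction "mi_size k" arbitrary: k)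
  case 0
  then have "k = 0" by (simp add: mi_size_eq_0_iff)
  with assms(1) show ?case by simp
next
  case (Suc m)
  then obtain i where "k $ i \<noteq> 0"
    by (metis mi_size_def sum.neutral nat.distinct(1))
  then have le: "axis i 1 \<le> k"
    by (auto simp: less_eq_vec_def axis_def)
  with Suc.hyps(2) have "m = mi_size (k - axis i 1)"
    by (simp add: mi_size_diff)
  from assms(2)[OF Suc.hyps(1)[OF this], of i] le show ?case
    by (simp add: mi_add_diff add.commute)
qed

subsection \<open>Monomials\<close>

lemma monomial_0: "monomial 0 = (\<lambda>x. 1)"
  by (simp add: monomial_def)

lemma monomial_axis: "monomial (axis i 1) = (\<lambda>x :: real ^ 'd::finite. x $ i)"
proof
  fix x :: "real ^ 'd"
  have "monomial (axis i 1) x = (\<Prod>j\<in>UNIV. if j = i then x $ j else 1)"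
    unfolding monomial_def by (intro prod.cong) (auto simp: axis_def)
  then show "monomial (axis i 1) x = x $ i" by simp
qed

lemma monomial_add:
  "monomial n (x + y) = (\<Sum>k | k \<le> n. real (mi_choose n k) * monomial k x * monomial (n - k) y)"
proof -
  have "monomial n (x + y) =
      (\<Prod>i\<in>UNIV. \<Sum>j\<in>{..n $ i}. real (n $ i choose j) * (x $ i) ^ j * (y $ i) ^ (n $ i - j))"
    by (simp add: monomial_def binomial_ring)
  \<comment> \<open>Expanding the product of sums chooses one exponent per coordinate; such a choice
    function is a multi-index below \<open>n\<close>.\<close>
  also have "\<dots> = (\<Sum>g\<in>PiE UNIV (\<lambda>i. {..n $ i}).
      \<Prod>i\<in>UNIV. real (n $ i choose g i) * (x $ i) ^ g i * (y $ i) ^ (n $ i - g i))"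
    by (rule prod_sum_PiE) auto
  also have "\<dots> = (\<Sum>k | k \<le> n. \<Prod>i\<in>UNIV.
      real (n $ i choose k $ i) * (x $ i) ^ (k $ i) * (y $ i) ^ (n $ i - k $ i))"
    by (rule sum.reindex_bij_witness[of _ "($)" vec_lambda]) (auto simp: less_eq_vec_def)
  finally show ?thesis
    by (simp add: monomial_def mi_choose_def prod.distrib)
qed

text \<open>
  Dedekind's independence of characters: distinct multi-indices \<open>k\<close>, \<open>l\<close> are told apart by
  doubling a coordinate, which multiplies \<open>monomial k\<close> and \<open>monomial l\<close> by different factors.
\<close>

lemma monomials_independent:
  fixes c :: "nat ^ 'd::finite \<Rightarrow> real"
  assumes "finite S" "\<And>x. (\<Sum>k\<in>S. c k * monomial k x) = 0" "k \<in> S"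
  shows "c k = 0"
  using assms
proof (induction S arbitrary: c k rule: finite_induct)
  case (insert l S)
  have S: "c j = 0" if "j \<in> S" for j
  proof -
    from insert.hyps that have "j \<noteq> l" by auto
    then obtain i where i: "j $ i \<noteq> l $ i" by (auto simp: vec_eq_iff)
    let ?dbl = "\<lambda>x :: real ^ 'd. \<chi> r. if r = i then 2 * x $ r else x $ r"
    have dbl: "monomial k (?dbl x) = 2 ^ (k $ i) * monomial k x" for k x
    proof -
      have "monomial k (?dbl x) =
          (\<Prod>r\<in>UNIV. (if r = i then 2 ^ (k $ i) else 1) * x $ r ^ (k $ r))"
        unfolding monomial_def by (intro prod.cong) (auto simp: power_mult_distrib)
      then show ?thesis by (simp add: prod.distrib monomial_def)
    qed
    \<comment> \<open>Subtracting \<open>2 ^ (l $ i)\<close> times the relation from its doubled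
      form cancels the \<open>l\<close> term and scales the coefficient of \<open>j\<close> by a
      nonzero factor.\<close>
    have "(\<Sum>k\<in>S. c k * (2 ^ (k $ i) - 2 ^ (l $ i)) * monomial k x) = 0" for x
    proof -
      have "(\<Sum>k\<in>insert l S. c k * monomial k (?dbl x))
          - 2 ^ (l $ i) * (\<Sum>k\<in>insert l S. c k * monomial k x) = 0"
        by (simp only: insert.prems)
      also have "(\<Sum>k\<in>insert l S. c k * monomial k (?dbl x))
          - 2 ^ (l $ i) * (\<Sum>k\<in>insert l S. c k * monomial k x)
          = (\<Sum>k\<in>insert l S. c k * (2 ^ (k $ i) - 2 ^ (l $ i)) * monomial k x)"
        by (simp add: dbl sum_distrib_left algebra_simps flip: sum_subtractf del: sum.insert)
      also have "\<dots> = (\<Sum>k\<in>S. c k * (2 ^ (k $ i) - 2 ^ (l $ i)) * monomial k x)"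
        using insert.hyps by simp
      finally show ?thesis .
    qed
    from insert.IH[OF this that] i show "c j = 0" by simp
  qed
  \<comment> \<open>With the other coefficients gone, the all-ones vector, where every monomial is
    1, isolates \<open>c l\<close>.\<close>
  have "c l * monomial l (\<chi> i. 1) = 0"
    using insert.prems(1)[of "\<chi> i. 1"] insert.hyps by (simp add: S)
  then have "c l = 0" by (simp add: monomial_def)
  with S insert.prems show ?case by auto
qed auto

subsection \<open>Shift-invariant operators\<close>

definition shift :: "real ^ 'd \<Rightarrow> (real ^ 'd \<Rightarrow> real) \<Rightarrow> real ^ 'd \<Rightarrow> real" where
  "shift v f = (\<lambda>x. f (x + v))"

lemma shift_shift: "shift v (shift w f) = shift (v + w) f"
  by (simp add: shift_def algebra_simps)

lemma subspace_polys: "subspace (polys :: (real ^ 'd::finite \<Rightarrow> real) set)"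
  unfolding polys_eq_span_monomials by (rule subspace_span)

lemmas polys_closure = subspace_add[OF subspace_polys] subspace_diff[OF subspace_polys]
  subspace_scale[OF subspace_polys] subspace_sum[OF subspace_polys] subspace_0[OF subspace_polys]

lemma polys_induct [consumes 1, case_names 0 step]:
  assumes "f \<in> polys" "P 0"
    and "\<And>c k g. g \<in> polys \<Longrightarrow> P g \<Longrightarrow> P (c *\<^sub>R monomial k + g)"
  shows "P f"
proof -
  from assms(1) have "f \<in> span (range monomial)"
    by (simp only: polys_eq_span_monomials)
  \<comment> \<open>Membership is carried along because operators are assumed linear only on
    \<open>polys\<close>, so the inductive step must offer it.\<close>
  then have "f \<in> polys \<and> P f"
  proof (induction rule: span_induct_alt)
    case base
    show ?case using assms(2) polys_closure(5) by (auto simp: zero_fun_def)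
  next
    case (step c m g)
    then obtain k where "m = monomial k" by auto
    with step assms(3)[of g c k] show ?case
      using polys_closure(1)[OF polys_closure(3)[OF monomial_in_polys[of k], of c], of g]
      by (simp only: simp_thms)
  qed
  then show ?thesis ..
qed

text \<open>For fixed \<open>v\<close> the binomial expansion becomes an identity of functions, to
  which a linear operator can be applied term by term.\<close>

lemma shift_monomial:
  "shift v (monomial n) =
     (\<Sum>k | k \<le> n. (real (mi_choose n k) * monomial (n - k) v) *\<^sub>R monomial k)"
  by (auto simp: shift_def fun_eq_iff monomial_add sum_fun_apply scaleR_fun_def algebra_simps
      intro!: sum.cong)

lemma shift_polys: "f \<in> polys \<Longrightarrow> shift v f \<in> polys"
proof (induction rule: polys_induct)
  case 0
  then show ?case using polys_closure(5) by (simp add: shift_def zero_fun_def)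
next
  case (step c k g)
  have "shift v (c *\<^sub>R monomial k + g) = c *\<^sub>R shift v (monomial k) + shift v g"
    by (simp add: shift_def scaleR_fun_def fun_eq_iff)
  then show ?case
    using step unfolding shift_monomial
    by (simp only: ) (intro polys_closure monomial_in_polys)
qed

context
  fixes T :: "(real ^ 'd::finite \<Rightarrow> real) \<Rightarrow> (real ^ 'd \<Rightarrow> real)"
  assumes T: "shift_invariant_op T"
begin

lemma op_polys: "f \<in> polys \<Longrightarrow> T f \<in> polys"
  and op_add: "f \<in> polys \<Longrightarrow> g \<in> polys \<Longrightarrow> T (f + g) = T f + T g"
  and op_scaleR: "f \<in> polys \<Longrightarrow> T (c *\<^sub>R f) = c *\<^sub>R T f"
  and op_shift: "f \<in> polys \<Longrightarrow> T (shift v f) = shift v (T f)"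
  using T unfolding shift_invariant_op_def shift_def by blast+

lemma op_0: "T 0 = 0"
  using op_scaleR[OF polys_closure(5), of 0] by simp

lemma op_diff: "f \<in> polys \<Longrightarrow> g \<in> polys \<Longrightarrow> T (f - g) = T f - T g"
  using op_add[of f "-1 *\<^sub>R g"] op_scaleR[of g "-1"] polys_closure(3)[of g "-1"] by simp

lemma op_sum:
  "(\<And>i. i \<in> S \<Longrightarrow> f i \<in> polys) \<Longrightarrow> T (\<Sum>i\<in>S. c i *\<^sub>R f i) = (\<Sum>i\<in>S. c i *\<^sub>R T (f i))"
proof (induction S rule: infinite_finite_induct)
  case (insert i S)
  have "c i *\<^sub>R f i \<in> polys" "(\<Sum>i\<in>S. c i *\<^sub>R f i) \<in> polys"
    by (intro polys_closure insert.prems; simp)+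
  moreover have "T (\<Sum>i\<in>S. c i *\<^sub>R f i) = (\<Sum>i\<in>S. c i *\<^sub>R T (f i))"
    by (rule insert.IH) (rule insert.prems, simp)
  moreover have "T (c i *\<^sub>R f i) = c i *\<^sub>R T (f i)"
    by (intro op_scaleR insert.prems) simp
  ultimately show ?case
    by (simp only: sum.insert[OF insert.hyps] op_add)
qed (auto simp: op_0)

text \<open>Evaluating at \<open>x\<close> is shifting by \<open>x\<close> and evaluating at 0, and
  \<open>T\<close> passes through the shift. The formula is the power series of \<open>T\<close> in
  the partial derivatives, with coefficients \<open>T (monomial k) 0 / mi_fact k\<close>, applied to
  a monomial.\<close>

lemma op_monomial:
  "T (monomial n) =
     (\<Sum>k | k \<le> n. (real (mi_choose n k) * T (monomial k) 0) *\<^sub>R monomial (n - k))"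
proof
  fix x
  have "T (monomial n) x = T (shift x (monomial n)) 0"
    unfolding op_shift[OF monomial_in_polys] by (simp add: shift_def)
  also have "\<dots> = (\<Sum>k | k \<le> n. (real (mi_choose n k) * monomial (n - k) x) *\<^sub>R T (monomial k)) 0"
    by (subst shift_monomial, subst op_sum, rule monomial_in_polys, rule refl)
  also have "\<dots> = (\<Sum>k | k \<le> n. (real (mi_choose n k) * T (monomial k) 0) *\<^sub>R monomial (n - k)) x"
    by (simp add: sum_fun_apply scaleR_fun_def algebra_simps)
  finally show "T (monomial n) x = \<dots>" .
qed

end

lemma op_eqI:
  assumes S: "shift_invariant_op S" and T: "shift_invariant_op T"
    and "\<And>n. S (monomial n) 0 = T (monomial n) 0" "f \<in> polys"
  shows "S f = T f"
  using assms(4)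
proof (induction rule: polys_induct)
  case 0
  show ?case by (simp only: op_0[OF S] op_0[OF T])
next
  case (step c k g)
  have "S (monomial k) = T (monomial k)"
    by (simp only: op_monomial[OF S, of k] op_monomial[OF T, of k] assms(3))
  with step show ?case
    by (simp only: op_add[OF S] op_add[OF T] op_scaleR[OF S] op_scaleR[OF T] monomial_in_polys polys_closure)
qed

lemma shift_invariant_op_id: "shift_invariant_op id"
  by (simp add: shift_invariant_op_def)

lemma shift_invariant_op_comp:
  assumes S: "shift_invariant_op S" and T: "shift_invariant_op T"
  shows "shift_invariant_op (S \<circ> T)"
  unfolding shift_invariant_op_def shift_def[symmetric] o_def
  by (intro conjI ballI allI; simp only: op_polys[OF T] op_polys[OF S] op_shift[OF T] op_shift[OF S]
      op_add[OF T] op_add[OF S] op_scaleR[OF T] op_scaleR[OF S])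

lemma shift_invariant_op_funpow: "shift_invariant_op S \<Longrightarrow> shift_invariant_op (S ^^ n)"
  by (induction n) (simp_all only: funpow.simps shift_invariant_op_id shift_invariant_op_comp)

text \<open>The values of a composition on monomials at 0 are the binomial convolution of those of
  its two factors. Convolution is symmetric under \<open>k \<mapsto> n - k\<close>, and these values
  determine the operator by \<open>op_eqI\<close>.\<close>

lemma op_commute:
  assumes S: "shift_invariant_op S" and T: "shift_invariant_op T" and f: "f \<in> polys"
  shows "S (T f) = T (S f)"
proof -
  have ST: "S (T (monomial n)) 0 =
      (\<Sum>k | k \<le> n. real (mi_choose n k) * T (monomial k) 0 * S (monomial (n - k)) 0)"
    if "shift_invariant_op S" "shift_invariant_op T" for n S T
    by (subst op_monomial[OF that(2)], subst op_sum[OF that(1) monomial_in_polys])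
       (simp add: sum_fun_apply scaleR_fun_def)
  have "(S \<circ> T) (monomial n) 0 = (T \<circ> S) (monomial n) 0" for n
  proof -
    let ?F = "\<lambda>k. real (mi_choose n k) * T (monomial k) 0 * S (monomial (n - k)) 0"
    have "(T \<circ> S) (monomial n) 0 = (\<Sum>k | k \<le> n. ?F (n - k))"
      by (auto simp: ST[OF T S] mi_diff_diff mi_choose_symmetric intro!: sum.cong)
    from trans[OF this sum_mi_reflect[of ?F n]] show ?thesis
      by (simp only: o_apply ST[OF S T])
  qed
  then show ?thesis
    using op_eqI[OF shift_invariant_op_comp[OF S T] shift_invariant_op_comp[OF T S] _ f] by simp
qed

subsection \<open>Degrees\<close>

text \<open>With a strict bound, \<open>degree_less 0\<close> is \<open>{0}\<close>, so the zero
  polynomial is covered and serves as base case of inductions on the degree.\<close>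

definition degree_less :: "nat \<Rightarrow> (real ^ 'd::finite \<Rightarrow> real) set" where
  "degree_less m = span (monomial ` {k. mi_size k < m})"

lemma degree_less_subset: "degree_less m \<subseteq> polys"
  unfolding degree_less_def polys_eq_span_monomials by (rule span_mono) auto

lemma degree_less_polys: "f \<in> degree_less m \<Longrightarrow> f \<in> polys"
  using degree_less_subset by (rule subsetD)

lemma degree_less_mono: "m \<le> n \<Longrightarrow> degree_less m \<subseteq> degree_less n"
  unfolding degree_less_def by (rule span_mono) auto

lemma degree_less_0: "degree_less 0 = {0}"
  by (simp add: degree_less_def)

lemma polys_degree_less: "f \<in> polys \<Longrightarrow> \<exists>m. f \<in> degree_less m"
proof (induction rule: polys_induct)
  case 0
  show ?case unfolding degree_less_def using span_zero by blast
next
  case (step c k g)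
  then obtain m where m: "g \<in> degree_less m" by auto
  let ?m = "max m (Suc (mi_size k))"
  have "g \<in> degree_less ?m" "monomial k \<in> degree_less ?m"
    using m degree_less_mono[of m ?m] by (auto simp: degree_less_def intro: span_base)
  then show ?case
    unfolding degree_less_def using span_add span_scale by blast
qed

lemma has_degree_iff: "has_degree f m \<longleftrightarrow> f \<in> degree_less (Suc m) \<and> f \<notin> degree_less m"
  by (simp add: has_degree_def degree_less_def less_Suc_eq_le)

text \<open>The \<open>k = 0\<close> term of the expansion \<open>op_monomial\<close> is the only one that preserves the degree.\<close>

lemma op_degree_less:
  assumes T: "shift_invariant_op T" and 1: "T (\<lambda>x. 1) = 0" and f: "f \<in> degree_less m"
  shows "T f \<in> degree_less (m - 1)"
  using f unfolding degree_less_def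
proof -
  let ?V = "span (monomial ` {k. mi_size k < m - 1}) :: (real ^ 'a \<Rightarrow> real) set"
  have mon: "T (monomial n) \<in> ?V" if "mi_size n < m" for n
  proof -
    have "(real (mi_choose n k) * T (monomial k) 0) *\<^sub>R monomial (n - k) \<in> ?V" if "k \<le> n" for k
    proof (cases "k = 0")
      case True
      then show ?thesis using 1 by (simp add: monomial_0 span_zero)
    next
      case False
      with \<open>k \<le> n\<close> \<open>mi_size n < m\<close> have "mi_size (n - k) < m - 1"
        using mi_size_diff[of k n] mi_size_mono[of k n] mi_size_eq_0_iff[of k] by linarith
      then show ?thesis by (intro span_scale span_base) auto
    qed
    then show ?thesis
      by (subst op_monomial[OF T]) (auto intro!: span_sum)
  qed
  from f have "f \<in> span (monomial ` {k. mi_size k < m})" by (simp add: degree_less_def)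
  then have "f \<in> degree_less m \<and> T f \<in> ?V"
  proof (induction rule: span_induct_alt)
    case base
    show ?case
      unfolding zero_fun_def[symmetric] op_0[OF T] degree_less_def by (intro conjI span_zero)
  next
    case (step c h g)
    then obtain n where n: "h = monomial n" "mi_size n < m" by auto
    from step have g: "g \<in> polys"
      using subsetD[OF degree_less_subset] by metis
    have "monomial n \<in> span (monomial ` {k. mi_size k < m})"
      by (rule span_base) (use n in simp)
    with step n have "c *\<^sub>R h + g \<in> degree_less m"
      unfolding degree_less_def by (metis span_add span_scale)
    moreover have "T (c *\<^sub>R h + g) = c *\<^sub>R T h + T g"
      unfolding n(1) op_add[OF T polys_closure(3)[OF monomial_in_polys] g]
        op_scaleR[OF T monomial_in_polys] ..
    ultimately show ?case
      using step mon[OF n(2)] n(1) by (metis span_add span_scale)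
  qed
  then show "T f \<in> ?V" by blast
qed

subsection \<open>Delta systems\<close>

text \<open>On each ray, \<open>g (t *\<^sub>R x) - t * g x\<close> is a polynomial in
  \<open>t\<close> that additivity forces to vanish at all natural numbers, hence
  everywhere.\<close>

lemma additive_poly_linear:
  fixes g :: "real ^ 'd::finite \<Rightarrow> real"
  assumes poly: "g \<in> polys" and add: "\<And>x y. g (x + y) = g x + g y"
  shows "linear g"
proof (rule linearI)
  show "g (r *\<^sub>R x) = r *\<^sub>R g x" for r x
  proof -
    have g0: "g 0 = 0" using add[of 0 0] by simp
    let ?h = "\<lambda>t :: real. g (t *\<^sub>R x) - t * g x"
    have "real_polynomial_function (g \<circ> (\<lambda>t :: real. t *\<^sub>R x))"
      using poly by (intro real_polynomial_function_compose polynomial_function_bounded_linear) 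
        (auto intro: bounded_linear_scaleR_left)
    moreover have "real_polynomial_function (\<lambda>t :: real. t * g x)"
      by (intro real_polynomial_function.intros bounded_linear_mult_left)
    ultimately have "real_polynomial_function ?h"
      by (auto simp: o_def intro: real_polynomial_function_diff)
    then obtain c n where c: "?h = (\<lambda>t. \<Sum>i\<le>n. c i * t ^ i)"
      by (auto simp: real_polynomial_function_iff_sum)
    have "?h (real m) = 0" for m
      by (induction m) (simp_all add: g0 add scaleR_left_distrib ring_distribs)
    then have "range real \<subseteq> {t. (\<Sum>i\<le>n. c i * t ^ i) = 0}"
      by (auto simp flip: c[unfolded fun_eq_iff, rule_format])
    then have "infinite {t. (\<Sum>i\<le>n. c i * t ^ i) = 0}"
      using finite_subset[of "range real"] range_inj_infinite[OF inj_of_nat] by blast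
    then have "\<forall>i\<le>n. c i = 0" by (simp add: polyfun_finite_roots)
    then show ?thesis using fun_cong[OF c, of r] by simp
  qed
qed (rule add)

context
  fixes D :: "'d::{finite,linorder} \<Rightarrow> ((real, 'd) vec \<Rightarrow> real) \<Rightarrow> ((real, 'd) vec \<Rightarrow> real)"
  assumes D: "delta_system D"
begin

lemma delta_op: "shift_invariant_op (D i)"
  using D by (auto simp: delta_system_def)

lemma delta_linear:
  assumes "a \<noteq> (0 :: (real, 'd) vec)"
  obtains c where "\<And>i. D i (\<lambda>x. \<Sum>j\<in>UNIV. a $ j * x $ j) = (\<lambda>x. c i)" "\<exists>i. c i \<noteq> 0"
  using D assms unfolding delta_system_def by blast

lemma const_in_polys: "(\<lambda>x. 1 :: real) \<in> (polys :: ((real, 'd) vec \<Rightarrow> real) set)"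
  using monomial_in_polys[of 0] by (simp only: monomial_0)

text \<open>Shifting a coordinate function along its axis adds 1 to it, but leaves its constant
  image under \<open>D i\<close> unchanged; so 1 is sent to 0.\<close>

lemma delta_1: "D i (\<lambda>x. 1) = 0"
proof -
  define j :: 'd where "j = undefined"
  let ?p = "(\<lambda>x. x $ j) :: (real, 'd) vec \<Rightarrow> real"
  have p: "?p \<in> polys"
    using monomial_in_polys[of "axis j 1"] by (simp only: monomial_axis)
  have "axis j (1::real) \<noteq> 0" by (simp add: axis_eq_0_iff)
  then obtain c where "D i (\<lambda>x. \<Sum>k\<in>UNIV. axis j 1 $ k * x $ k) = (\<lambda>x. c i)"
    by (rule delta_linear) blast
  moreover have "(\<lambda>x :: (real, 'd) vec. \<Sum>k\<in>UNIV. axis j 1 $ k * x $ k) = ?p"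
    by (simp add: axis_def if_distrib[of "\<lambda>x. x * _"] cong: if_cong)
  ultimately have c: "D i ?p = (\<lambda>x. c i)" by simp
  have "shift (axis j 1) ?p = ?p + (\<lambda>x. 1)"
    by (simp add: shift_def fun_eq_iff axis_def)
  then have "shift (axis j 1) (D i ?p) = D i ?p + D i (\<lambda>x. 1)"
    using op_shift[OF delta_op p, of i "axis j 1"] op_add[OF delta_op p const_in_polys, of i]
    by simp
  then show ?thesis
    unfolding c by (simp add: shift_def fun_eq_iff)
qed

text \<open>
  The joint kernel of the \<open>D i\<close> is shift-invariant, so differencing reduces the claim to affine
  functions, on which it is the defining property of a delta system.
\<close>

lemma delta_kernel:
  assumes "f \<in> polys" "\<And>i. D i f = 0"
  shows "f x = f 0"
proof -
  from assms(1) obtain m where "f \<in> degree_less m"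
    using polys_degree_less by blast
  then show ?thesis
    using assms(2)
  proof (induction m arbitrary: f x)
    case 0
    then show ?case by (simp add: degree_less_0)
  next
    case (Suc m)
    have f: "f \<in> polys" by (rule degree_less_polys[OF Suc.prems(1)])
    have diff: "f (x + v) - f x = f v - f 0" for x v
    proof -
      \<comment> \<open>The difference operator is shift-invariant and kills constants, so it lowers
        the degree and commutes with every \<open>D i\<close>; the induction hypothesis applies to
        the difference of \<open>f\<close>.\<close>
      let ?\<Delta> = "\<lambda>f. shift v f - f"
      have op: "shift_invariant_op ?\<Delta>"
        unfolding shift_invariant_op_def
        by (intro conjI ballI allI polys_closure shift_polys; assumption?)
           (auto simp: shift_def scaleR_fun_def fun_eq_iff algebra_simps)
      have "?\<Delta> (\<lambda>x. 1) = 0" by (simp add: shift_def fun_eq_iff)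
      from op_degree_less[OF op this Suc.prems(1)] have "?\<Delta> f \<in> degree_less m"
        by (simp only: diff_Suc_1)
      moreover have "D i (?\<Delta> f) = 0" for i
        unfolding op_commute[OF delta_op op f] Suc.prems(2) by (rule op_0[OF op])
      ultimately have "?\<Delta> f x = ?\<Delta> f 0" by (rule Suc.IH)
      then show ?thesis by (simp add: shift_def)
    qed
    \<comment> \<open>By \<open>diff\<close>, removing the constant term leaves an additive
      polynomial, hence a linear form. Were it nonzero, the delta property would make some
      \<open>D i g\<close> nonzero.\<close>
    define g where "g = f - f 0 *\<^sub>R (\<lambda>x. 1)"
    have g: "g \<in> polys"
      unfolding g_def by (intro polys_closure f const_in_polys)
    have Dg: "D i g = 0" for i
      unfolding g_def op_diff[OF delta_op f polys_closure(3)[OF const_in_polys]]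
        op_scaleR[OF delta_op const_in_polys] by (simp add: delta_1 Suc.prems fun_eq_iff)
    have "linear g"
    proof (rule additive_poly_linear[OF g])
      show "g (x + y) = g x + g y" for x y
        using diff[of x y] by (simp add: g_def scaleR_fun_def)
    qed
    define a where "a = (\<chi> j. g (axis j 1))"
    have ga: "g x = (\<Sum>j\<in>UNIV. a $ j * x $ j)" for x
    proof -
      have "g x = g (\<Sum>j\<in>UNIV. x $ j *\<^sub>R axis j 1)"
        by (simp add: basis_expansion flip: scalar_mult_eq_scaleR)
      also have "\<dots> = (\<Sum>j\<in>UNIV. x $ j * g (axis j 1))"
        by (simp add: linear_sum[OF \<open>linear g\<close>] linear_cmul[OF \<open>linear g\<close>])
      finally show ?thesis by (simp add: a_def mult.commute)
    qed
    have "a = 0"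
    proof (rule ccontr)
      assume "a \<noteq> 0"
      then obtain c where "\<And>i. D i g = (\<lambda>x. c i)" "\<exists>i. c i \<noteq> 0"
        using delta_linear[of a] unfolding ga[abs_def] by metis
      with Dg show False by (metis zero_fun_apply)
    qed
    then have "g x = 0" by (simp add: ga)
    then show ?case by (simp add: g_def scaleR_fun_def)
  qed
qed

text \<open>Arbitrary lists replace the sorted list of all indices so that induction is
  possible.\<close>

lemma delta_foldr_op: "shift_invariant_op (foldr (\<lambda>i T. (D i ^^ (k $ i)) \<circ> T) xs id)"
proof (induction xs)
  case Nil
  show ?case using shift_invariant_op_id by (simp add: id_def)
next
  case (Cons i xs)
  have eq: "foldr (\<lambda>i T. (D i ^^ (k $ i)) \<circ> T) (i # xs) id =
      (D i ^^ (k $ i)) \<circ> foldr (\<lambda>i T. (D i ^^ (k $ i)) \<circ> T) xs id"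
    by simp
  show ?case
    unfolding eq by (rule shift_invariant_op_comp[OF shift_invariant_op_funpow[OF delta_op] Cons.IH])
qed

lemma delta_power_op: "shift_invariant_op (delta_power D k)"
  unfolding delta_power_def by (rule delta_foldr_op)

lemma delta_power_0: "delta_power D 0 f = f"
proof -
  have "foldr (\<lambda>i T. (D i ^^ ((0 :: (nat, 'd) vec) $ i)) \<circ> T) xs id = id" for xs :: "'d list"
    by (induction xs) auto
  then show ?thesis by (simp add: delta_power_def)
qed

lemma delta_power_axis: "delta_power D (axis i 1) f = D i f"
proof -
  have "foldr (\<lambda>j T. (D j ^^ ((axis i 1 :: (nat, 'd) vec) $ j)) \<circ> T) xs id =
      (if i \<in> set xs then D i else id)" if "distinct xs" for xs :: "'d list"
    using that by (induction xs) (auto simp: axis_def)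
  from this[of "sorted_list_of_set UNIV"] show ?thesis
    by (simp add: delta_power_def)
qed

lemma delta_power_add:
  assumes "f \<in> polys"
  shows "delta_power D (k + l) f = delta_power D k (delta_power D l f)"
proof -
  let ?P = "\<lambda>k xs. foldr (\<lambda>i T. (D i ^^ (k $ i)) \<circ> T) xs id"
  have P_Cons: "?P k (i # xs) f = (D i ^^ (k $ i)) (?P k xs f)" for k i xs f
    by simp
  have "?P (k + l) xs f = ?P k xs (?P l xs f)" for xs
  proof (induction xs)
    case (Cons i xs)
    let ?g = "?P l xs f"
    have g: "?g \<in> polys" by (rule op_polys[OF delta_foldr_op assms])
    have "?P (k + l) (i # xs) f = (D i ^^ (k $ i)) ((D i ^^ (l $ i)) (?P k xs ?g))"
      unfolding P_Cons Cons vector_add_component[of k l i] funpow_add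
      by (rule o_apply)
    \<comment> \<open>Commutativity moves this power of \<open>D i\<close> past the factors
      belonging to \<open>k\<close>, to its place in the product for \<open>l\<close>.\<close>
    also have "(D i ^^ (l $ i)) (?P k xs ?g) = ?P k xs ((D i ^^ (l $ i)) ?g)"
      by (rule op_commute[OF shift_invariant_op_funpow[OF delta_op] delta_foldr_op g])
    finally show ?case by (simp only: P_Cons)
  qed auto
  then show ?thesis by (simp only: delta_power_def)
qed

lemma delta_power_degree:
  "f \<in> degree_less m \<Longrightarrow> delta_power D k f \<in> degree_less (m - mi_size k)"
proof (induction k arbitrary: f m rule: mi_induct)
  case zero
  then show ?case by (simp add: delta_power_0)
next
  case (add k i)
  from add.IH[OF op_degree_less[OF delta_op delta_1 add.prems, of i]] show ?case
    by (simp add: delta_power_add[OF degree_less_polys[OF add.prems]] delta_power_axis[simplified] mi_size_add)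
qed

lemma delta_power_vanish:
  "f \<in> degree_less m \<Longrightarrow> m \<le> mi_size k \<Longrightarrow> delta_power D k f = 0"
  using delta_power_degree[of f m k] by (simp add: degree_less_0)

lemma delta_separating:
  assumes "f \<in> polys" "\<And>k. delta_power D k f (z k) = 0"
  shows "f = 0"
proof -
  from assms(1) obtain m where "f \<in> degree_less m"
    using polys_degree_less by blast
  then show ?thesis
    using assms(2)
  proof (induction m arbitrary: f z)
    case 0
    then show ?case by (simp add: degree_less_0)
  next
    case (Suc m)
    have f: "f \<in> polys" by (rule degree_less_polys[OF Suc.prems(1)])
    have "D i f = 0" for i
    proof (rule Suc.IH)
      show "D i f \<in> degree_less m"
        using op_degree_less[OF delta_op delta_1 Suc.prems(1)] by simp
      \<comment> \<open>The conditions on \<open>D i f\<close> live on the grid shifted by a unit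
        multi-index, which is why \<open>z\<close> is generalized in the induction.\<close>
      show "delta_power D k (D i f) (z (k + axis i 1)) = 0" for k
        using Suc.prems(2)[of "k + axis i 1"] by (simp only: delta_power_add[OF f] delta_power_axis)
    qed
    from delta_kernel[OF f this] have *: "f x = f 0" for x .
    \<comment> \<open>The condition for \<open>k = 0\<close> makes the constant \<open>f\<close>
      vanish at \<open>z 0\<close>.\<close>
    with Suc.prems(2)[of 0] have "f x = 0" for x
      by (simp only: delta_power_0 *[of "z 0"] *[of x])
    then show ?case by (simp add: fun_eq_iff)
  qed
qed

lemma delta_eqI:
  assumes "f \<in> polys" "g \<in> polys" "\<And>k. delta_power D k f (z k) = delta_power D k g (z k)"
  shows "f = g"
proof -
  have "f - g = 0"
  proof (rule delta_separating[of _ z])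
    show "f - g \<in> polys" by (rule polys_closure(2)[OF assms(1,2)])
    show "delta_power D k (f - g) (z k) = 0" for k
      unfolding op_diff[OF delta_power_op assms(1,2)] by (simp add: assms(3))
  qed
  then show ?thesis by simp
qed

lemma delta_power_sum:
  assumes "\<And>i. i \<in> S \<Longrightarrow> f i \<in> polys"
  shows "delta_power D k (\<Sum>i\<in>S. c i *\<^sub>R f i) x = (\<Sum>i\<in>S. c i * delta_power D k (f i) x)"
  by (subst op_sum[OF delta_power_op assms]) (simp_all add: sum_fun_apply scaleR_fun_def)

end

subsection \<open>Goncarov polynomials\<close>

text \<open>The columns are independent. If \<open>b\<close> lay outside their span, adjoining it
  would give more than \<open>card I\<close> independent vectors in a space spanned by
  \<open>card I\<close> unit vectors.\<close>

lemma square_system_solvable: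
  fixes a :: "'i \<Rightarrow> 'i \<Rightarrow> real"
  assumes I: "finite I"
    and inj: "\<And>c j. (\<And>k. k \<in> I \<Longrightarrow> (\<Sum>j\<in>I. c j * a k j) = 0) \<Longrightarrow> j \<in> I \<Longrightarrow> c j = 0"
  shows "\<exists>c. \<forall>k\<in>I. (\<Sum>j\<in>I. c j * a k j) = b k"
proof -
  \<comment> \<open>Setting entries outside \<open>I\<close> to 0 keeps all vectors in the span of
    the finitely many unit vectors indexed by \<open>I\<close>.\<close>
  define col where "col j = (\<lambda>k. if k \<in> I then a k j else 0)" for j
  define unit :: "'i \<Rightarrow> 'i \<Rightarrow> real" where "unit j = (\<lambda>k. if k = j then 1 else 0)" for j
  define b' where "b' = (\<lambda>k. if k \<in> I then b k else 0)"
  have expand: "f = (\<Sum>j\<in>I. f j *\<^sub>R unit j)" if "\<And>k. k \<notin> I \<Longrightarrow> f k = 0" for f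
    using that I by (auto simp: fun_eq_iff sum_fun_apply scaleR_fun_def unit_def if_distrib sum.delta cong: if_cong)
  have in_units: "f \<in> span (unit ` I)" if "\<And>k. k \<notin> I \<Longrightarrow> f k = 0" for f
    by (subst expand[OF that], assumption) (intro span_sum span_scale span_base imageI)
  have comb: "(\<Sum>j\<in>I. c j *\<^sub>R col j) k = (\<Sum>j\<in>I. c j * a k j)" if "k \<in> I" for c k
    using that by (simp add: sum_fun_apply scaleR_fun_def col_def)
  \<comment> \<open>Two equal columns would give a nontrivial relation with coefficients 1 and
    -1.\<close>
  have inj_col: "inj_on col I"
  proof (rule inj_onI, rule ccontr)
    fix i j assume ij: "i \<in> I" "j \<in> I" "col i = col j" "i \<noteq> j"
    have "(\<Sum>r\<in>I. (unit i r - unit j r) * a k r) = 0" if "k \<in> I" for k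
      using fun_cong[OF ij(3), of k] that ij I
      by (simp add: unit_def left_diff_distrib sum_subtractf if_distrib[of "\<lambda>x. x * _"] sum.delta col_def
          cong: if_cong)
    from inj[OF this ij(1)] ij(4) show False by (simp add: unit_def)
  qed
  have indep: "independent (col ` I)"
  proof (rule independent_if_scalars_zero)
    fix u v assume u: "(\<Sum>x\<in>col ` I. u x *\<^sub>R x) = 0" and v: "v \<in> col ` I"
    from v obtain j where j: "v = col j" "j \<in> I" by auto
    from u have eq: "(\<Sum>j\<in>I. u (col j) *\<^sub>R col j) = 0"
      by (simp only: sum.reindex[OF inj_col] o_def)
    have "(\<Sum>j\<in>I. u (col j) * a k j) = 0" if "k \<in> I" for k
      using comb[OF that, of "\<lambda>j. u (col j)"] fun_cong[OF eq, of k] by simp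
    from inj[OF this j(2)] j(1) show "u v = 0" by simp
  qed (use I in simp)
  have "b' \<in> span (col ` I)"
  proof (rule ccontr)
    assume nin: "b' \<notin> span (col ` I)"
    then have "independent (insert b' (col ` I))"
      by (intro independent_insertI indep)
    moreover have "insert b' (col ` I) \<subseteq> span (unit ` I)"
      using in_units by (auto simp: b'_def col_def)
    ultimately have "card (insert b' (col ` I)) \<le> card (unit ` I)"
      using independent_span_bound I by blast
    moreover have "card (insert b' (col ` I)) = Suc (card I)"
      using nin I span_base[of b' "col ` I"]
      by (subst card_insert_disjoint) (auto simp: card_image[OF inj_col])
    moreover have "card (unit ` I) \<le> card I" by (rule card_image_le[OF I])
    ultimately show False by simp
  qed
  then obtain u where "b' = (\<Sum>v\<in>col ` I. u v *\<^sub>R v)"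
    by (auto simp: span_finite I)
  then have eq: "b' = (\<Sum>j\<in>I. u (col j) *\<^sub>R col j)"
    by (simp only: sum.reindex[OF inj_col] o_def)
  have "(\<Sum>j\<in>I. u (col j) * a k j) = b k" if "k \<in> I" for k
    using fun_cong[OF eq, of k] comb[OF that, of "\<lambda>j. u (col j)"] that
    by (simp only: b'_def if_True)
  then show ?thesis by (intro exI[of _ "\<lambda>j. u (col j)"] ballI)
qed

text \<open>Conditions at all \<open>k\<close> replace membership in \<open>delta_space\<close>, so
  this version does not refer to the basic sequence. It agrees with \<open>delta_goncarov\<close> by
  \<open>delta_goncarov_eq\<close>.\<close>

definition goncarov_poly ::
    "('d::{finite,linorder} \<Rightarrow> ((real, 'd) vec \<Rightarrow> real) \<Rightarrow> ((real, 'd) vec \<Rightarrow> real)) \<Rightarrow>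
     ((nat, 'd) vec \<Rightarrow> (real, 'd) vec) \<Rightarrow> (nat, 'd) vec \<Rightarrow> (real, 'd) vec \<Rightarrow> real" where
  "goncarov_poly D z n =
     (THE t. t \<in> polys \<and> (\<forall>k. delta_power D k t (z k) = (if k = n then mi_fact n else 0)))"

section \<open>Existence, uniqueness and expansions for Goncarov polynomials\<close>

context
  fixes D :: "'d::{finite,linorder} \<Rightarrow> ((real, 'd) vec \<Rightarrow> real) \<Rightarrow> ((real, 'd) vec \<Rightarrow> real)"
  assumes D: "delta_system D"
begin

text \<open>Unknown coefficients and conditions are both indexed by the multi-indices of size at
  most \<open>mi_size n\<close>, and the homogeneous system has only the zero solution by
  \<open>delta_separating\<close>. Conditions of larger size hold automatically by degree.\<close>

lemma goncarov_exists:
  obtains t where "t \<in> degree_less (Suc (mi_size n))"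
    "\<And>k. delta_power D k t (z k) = (if k = n then mi_fact n else 0)"
proof -
  define I where "I = {k :: (nat, 'd) vec. mi_size k < Suc (mi_size n)}"
  have I: "finite I" unfolding I_def by (rule finite_mi_size_less)
  let ?a = "\<lambda>k j. delta_power D k (monomial j) (z k)"
  let ?f = "\<lambda>c. \<Sum>j\<in>I. c j *\<^sub>R monomial j :: (real, 'd) vec \<Rightarrow> real"
  have f: "?f c \<in> degree_less (Suc (mi_size n))" for c
    unfolding degree_less_def by (intro span_sum span_scale span_base) (auto simp: I_def)
  have eval: "delta_power D k (?f c) (z k) = (\<Sum>j\<in>I. c j * ?a k j)" for c k
    by (rule delta_power_sum[OF D monomial_in_polys])
  have outside: "delta_power D k (?f c) (z k) = 0" if "k \<notin> I" for c k
    using delta_power_vanish[OF D f, of k c] that by (simp add: I_def)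
  have inj: "c j = 0" if "\<And>k. k \<in> I \<Longrightarrow> (\<Sum>j\<in>I. c j * ?a k j) = 0" "j \<in> I" for c j
  proof -
    have "delta_power D k (?f c) (z k) = 0" for k
      using that(1) outside eval by metis
    from delta_separating[OF D degree_less_polys[OF f] this]
    have "(\<Sum>j\<in>I. c j * monomial j x) = 0" for x :: "(real, 'd) vec"
      by (auto simp: fun_eq_iff sum_fun_apply scaleR_fun_def)
    from monomials_independent[OF I this that(2)] show ?thesis .
  qed
  have "\<exists>c. \<forall>k\<in>I. (\<Sum>j\<in>I. c j * ?a k j) = (if k = n then mi_fact n else 0)"
    by (rule square_system_solvable[OF I]) (rule inj)
  then obtain c where c: "\<And>k. k \<in> I \<Longrightarrow> (\<Sum>j\<in>I. c j * ?a k j) = (if k = n then mi_fact n else 0)"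
    by blast
  show thesis
  proof (rule that[OF f[of c]])
    show "delta_power D k (?f c) (z k) = (if k = n then mi_fact n else 0)" for k
    proof (cases "k \<in> I")
      case True
      then show ?thesis using c eval by simp
    next
      case False
      then show ?thesis using outside by (auto simp: I_def)
    qed
  qed
qed

lemma goncarov_unique:
  assumes "t \<in> polys" "\<And>k. delta_power D k t (z k) = (if k = n then mi_fact n else 0)"
  shows "goncarov_poly D z n = t"
  unfolding goncarov_poly_def
proof (rule the_equality)
  show "t \<in> polys \<and> (\<forall>k. delta_power D k t (z k) = (if k = n then mi_fact n else 0))"
    by (intro conjI allI assms)
  show "s = t" if "s \<in> polys \<and> (\<forall>k. delta_power D k s (z k) = (if k = n then mi_fact n else 0))"
    for s
    by (rule delta_eqI[OF D, of _ _ z]) (use that assms in auto)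
qed

lemma goncarov_degree: "goncarov_poly D z n \<in> degree_less (Suc (mi_size n))"
  and goncarov_eval:
    "delta_power D k (goncarov_poly D z n) (z k) = (if k = n then mi_fact n else 0)"
proof -
  obtain t where t: "t \<in> degree_less (Suc (mi_size n))"
    "\<And>k. delta_power D k t (z k) = (if k = n then mi_fact n else 0)"
    by (rule goncarov_exists[of n z]) (rule that)
  note [simp] = goncarov_unique[OF degree_less_polys[OF t(1)] t(2)]
  show "goncarov_poly D z n \<in> degree_less (Suc (mi_size n))"
    "delta_power D k (goncarov_poly D z n) (z k) = (if k = n then mi_fact n else 0)"
    using t by simp_all
qed

lemma goncarov_in_polys: "goncarov_poly D z n \<in> polys"
  by (rule degree_less_polys[OF goncarov_degree])

lemma goncarov_has_degree: "has_degree (goncarov_poly D z n) (mi_size n)"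
proof -
  \<comment> \<open>In smaller degree the \<open>n\<close>-th delta power would vanish, but at
    \<open>z n\<close> it equals \<open>mi_fact n\<close>.\<close>
  have "goncarov_poly D z n \<notin> degree_less (mi_size n)"
    using delta_power_vanish[OF D, of "goncarov_poly D z n" "mi_size n" n]
      goncarov_eval[of n z n] mi_fact_pos[of n] by auto
  with goncarov_degree show ?thesis by (simp add: has_degree_iff)
qed

lemma goncarov_0: "goncarov_poly D z 0 = (\<lambda>x. 1)"
proof (rule goncarov_unique)
  have deg: "(\<lambda>x. 1) \<in> (degree_less 1 :: ((real, 'd) vec \<Rightarrow> real) set)"
    unfolding degree_less_def monomial_0[symmetric] by (rule span_base) simp
  then show "(\<lambda>x. 1) \<in> (polys :: ((real, 'd) vec \<Rightarrow> real) set)"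
    by (rule degree_less_polys)
  show "delta_power D k (\<lambda>x. 1) (z k) = (if k = 0 then mi_fact 0 else 0)" for k
  proof (cases "k = 0")
    case True
    then show ?thesis by (simp add: delta_power_0[OF D] mi_fact_def)
  next
    case False
    with mi_size_eq_0_iff[of k] have "1 \<le> mi_size k" by linarith
    with False show ?thesis by (simp add: delta_power_vanish[OF D deg])
  qed
qed

text \<open>Applying the \<open>l\<close>-th delta power at \<open>z (l + k)\<close> to the left
  side tests the polynomial of index \<open>n\<close> at position \<open>l + k\<close>, which is
  nonzero exactly for \<open>l = n - k\<close>. The factor adjusts the normalization.\<close>

lemma delta_power_goncarov:
  assumes "k \<le> n"
  shows "delta_power D k (goncarov_poly D z n) =
    (mi_fact n / mi_fact (n - k)) *\<^sub>R goncarov_poly D (\<lambda>l. z (l + k)) (n - k)"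
proof (rule delta_eqI[OF D, of _ _ "\<lambda>l. z (l + k)"])
  show "delta_power D k (goncarov_poly D z n) \<in> polys"
    by (rule op_polys[OF delta_power_op[OF D] goncarov_in_polys])
  show "(mi_fact n / mi_fact (n - k)) *\<^sub>R goncarov_poly D (\<lambda>l. z (l + k)) (n - k) \<in> polys"
    by (intro polys_closure goncarov_in_polys)
  fix l
  have eq: "l + k = n \<longleftrightarrow> l = n - k"
    using assms mi_add_diff[of k n] by (metis add.commute mi_add_diff_left)
  have "delta_power D l (delta_power D k (goncarov_poly D z n)) (z (l + k)) =
      (if l = n - k then mi_fact n else 0)"
    by (simp only: delta_power_add[OF D goncarov_in_polys, symmetric] goncarov_eval eq)
  moreover have "delta_power D l
      ((mi_fact n / mi_fact (n - k)) *\<^sub>R goncarov_poly D (\<lambda>l. z (l + k)) (n - k)) (z (l + k)) =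
      mi_fact n / mi_fact (n - k) * (if l = n - k then mi_fact (n - k) else 0)"
    using goncarov_eval[of l "\<lambda>l. z (l + k)" "n - k"]
    unfolding op_scaleR[OF delta_power_op[OF D] goncarov_in_polys]
    by (simp add: scaleR_fun_def)
  ultimately show "delta_power D l (delta_power D k (goncarov_poly D z n)) (z (l + k)) =
      delta_power D l
      ((mi_fact n / mi_fact (n - k)) *\<^sub>R goncarov_poly D (\<lambda>l. z (l + k)) (n - k)) (z (l + k))"
    using mi_fact_pos[of "n - k"] by simp
qed

text \<open>No \<open>l\<close> satisfies \<open>l + k = n\<close>, so every condition on the grid
  \<open>l \<mapsto> z (l + k)\<close> has value 0.\<close>

lemma delta_power_goncarov_eq_0:
  assumes "\<not> k \<le> n"
  shows "delta_power D k (goncarov_poly D z n) = 0"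
proof (rule delta_separating[OF D, of _ "\<lambda>l. z (l + k)"])
  show "delta_power D k (goncarov_poly D z n) \<in> polys"
    by (rule op_polys[OF delta_power_op[OF D] goncarov_in_polys])
  have "l + k \<noteq> n" for l
    using assms mi_le_add[of k l] by (auto simp: add.commute)
  then show "delta_power D l (delta_power D k (goncarov_poly D z n)) (z (l + k)) = 0" for l
    by (simp only: delta_power_add[OF D goncarov_in_polys, symmetric] goncarov_eval if_False)
qed

text \<open>The functionals \<open>f \<mapsto> delta_power D k f (z k)\<close> are dual to the
  Goncarov polynomials up to factorials. For sizes from \<open>m\<close> on they vanish on
  \<open>f\<close>, so the sum is finite.\<close>

lemma goncarov_expansion:
  assumes "f \<in> degree_less m"
  shows "f = (\<Sum>k | mi_size k < m. (delta_power D k f (z k) / mi_fact k) *\<^sub>R goncarov_poly D z k)"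
proof (rule delta_eqI[OF D degree_less_polys[OF assms], of _ z])
  let ?S = "{k :: (nat, 'd) vec. mi_size k < m}"
  show "(\<Sum>k\<in>?S. (delta_power D k f (z k) / mi_fact k) *\<^sub>R goncarov_poly D z k) \<in> polys"
    by (intro polys_closure goncarov_in_polys)
  fix k
  have "delta_power D k (\<Sum>k\<in>?S. (delta_power D k f (z k) / mi_fact k) *\<^sub>R goncarov_poly D z k) (z k)
      = (\<Sum>j\<in>?S. if j = k then delta_power D k f (z k) else 0)"
    by (subst delta_power_sum[OF D goncarov_in_polys], intro sum.cong refl)
       (auto simp: goncarov_eval)
  also have "\<dots> = delta_power D k f (z k)"
    using delta_power_vanish[OF D assms, of k]
    by (auto simp: sum.delta finite_mi_size_less not_less)
  finally show "delta_power D k f (z k) = delta_power D k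
      (\<Sum>k\<in>?S. (delta_power D k f (z k) / mi_fact k) *\<^sub>R goncarov_poly D z k) (z k)" ..
qed

text \<open>For \<open>m = 2\<close> this yields the condition on affine polynomials in
  \<open>binomial_type\<close>.\<close>

lemma degree_less_eq_span_goncarov:
  "degree_less m = span (goncarov_poly D z ` {k. mi_size k < m})"
proof
  show "degree_less m \<subseteq> span (goncarov_poly D z ` {k. mi_size k < m})"
  proof
    fix f :: "(real, 'd) vec \<Rightarrow> real" assume "f \<in> degree_less m"
    show "f \<in> span (goncarov_poly D z ` {k. mi_size k < m})"
      by (subst goncarov_expansion[OF \<open>f \<in> degree_less m\<close>, of z])
         (intro span_sum span_scale span_base imageI)
  qed
  have "goncarov_poly D z k \<in> degree_less m" if "mi_size k < m" for k
    using goncarov_degree[of z k] degree_less_mono[of "Suc (mi_size k)" m] that by auto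
  moreover have "subspace (degree_less m :: ((real, 'd) vec \<Rightarrow> real) set)"
    by (simp add: degree_less_def)
  ultimately show "span (goncarov_poly D z ` {k. mi_size k < m}) \<subseteq> degree_less m"
    by (intro span_minimal) auto
qed

section \<open>Agreement with the basic sequence and with \<open>delta_goncarov\<close>\<close>

lemma basic_sequence_eq: "basic_sequence D = goncarov_poly D (\<lambda>k. 0)"
  unfolding basic_sequence_def
proof (rule the_equality)
  \<comment> \<open>This is \<open>delta_power_goncarov\<close> for a unit multi-index; the zero
    grid is unchanged by shifting its index, so the same family reappears.\<close>
  have "D i (goncarov_poly D (\<lambda>k. 0) n) =
      real (n $ i) *\<^sub>R goncarov_poly D (\<lambda>k. 0) (n - axis i 1)" for i n
  proof (cases "n $ i = 0")
    case True
    then have "\<not> axis i 1 \<le> n"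
      by (auto simp: less_eq_vec_def axis_def)
    from delta_power_goncarov_eq_0[OF this] True show ?thesis
      by (simp add: delta_power_axis[OF D, simplified])
  next
    case False
    then have le: "axis i 1 \<le> n"
      by (auto simp: less_eq_vec_def axis_def)
    have "n = (n - axis i 1) + axis i 1"
      using mi_add_diff[OF le] by (simp add: add.commute)
    then have "mi_fact n = real (n $ i) * mi_fact (n - axis i 1)"
      using mi_fact_axis_add[of "n - axis i 1" i] False by (simp add: axis_def)
    with delta_power_goncarov[OF le, of "\<lambda>k. 0"] mi_fact_pos[of "n - axis i 1"] show ?thesis
      by (simp add: delta_power_axis[OF D, simplified])
  qed
  moreover have "goncarov_poly D (\<lambda>k. 0) n 0 = 0" if "mi_size n \<ge> 1" for n
    using goncarov_eval[of 0 "\<lambda>k. 0" n] that by (auto simp: delta_power_0[OF D])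
  ultimately show "is_basic_sequence D (goncarov_poly D (\<lambda>k. 0))"
    unfolding is_basic_sequence_def using goncarov_has_degree goncarov_0 by blast
next
  fix p assume "is_basic_sequence D p"
  then have deg: "has_degree (p n) (mi_size n)" and p0: "p 0 = (\<lambda>x. 1)"
    and pn: "mi_size n \<ge> 1 \<Longrightarrow> p n 0 = 0"
    and Dp: "D i (p n) = real (n $ i) *\<^sub>R p (n - axis i 1)" for i n
    unfolding is_basic_sequence_def by blast+
  have polys: "p n \<in> polys" for n
    using deg degree_less_polys unfolding has_degree_iff by blast
  \<comment> \<open>Conversely, the recursion for \<open>D i\<close> and the values at 0 fix all
    interpolation data, so uniqueness applies.\<close>
  have "delta_power D k (p n) 0 = (if k = n then mi_fact n else 0)" for k n
  proof (induction k arbitrary: n rule: mi_induct)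
    case zero
    show ?case
      using pn[of n] mi_size_eq_0_iff[of n]
      by (cases "n = 0") (auto simp: delta_power_0[OF D] p0 mi_fact_def Suc_le_eq)
  next
    case (add k i)
    have "delta_power D (k + axis i 1) (p n) 0 = real (n $ i) * delta_power D k (p (n - axis i 1)) 0"
      unfolding delta_power_add[OF D polys] delta_power_axis[OF D] Dp
        op_scaleR[OF delta_power_op[OF D] polys] by (simp add: scaleR_fun_def)
    also have "\<dots> = real (n $ i) * (if k = n - axis i 1 then mi_fact k else 0)"
      by (simp add: add.IH)
    also have "\<dots> = (if k + axis i 1 = n then mi_fact n else 0)"
    proof (cases "k + axis i 1 = n")
      case True
      then show ?thesis by (auto simp: mi_fact_axis_add[simplified])
    next
      case False
      \<comment> \<open>Truncated subtraction could make \<open>k = n - axis i 1\<close> hold by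
        accident only when \<open>n $ i = 0\<close>, and then the coefficient is 0.\<close>
      then have "n $ i = 0 \<or> k \<noteq> n - axis i 1"
        by (auto simp: vec_eq_iff axis_def split: if_splits)
      with False show ?thesis by auto
    qed
    finally show ?case .
  qed
  then have "goncarov_poly D (\<lambda>k. 0) n = p n" for n
    by (rule goncarov_unique[OF polys])
  then show "p = goncarov_poly D (\<lambda>k. 0)" by (simp add: fun_eq_iff)
qed

text \<open>Membership in \<open>delta_space D n\<close> amounts to the missing conditions. In the
  basic sequence the coefficients of \<open>goncarov_poly D z n\<close> outside
  \<open>k \<le> n\<close> vanish, and conversely the delta powers with
  \<open>\<not> k \<le> n\<close> kill that space.\<close>

lemma delta_goncarov_eq: "delta_goncarov D z n = goncarov_poly D z n"
  unfolding delta_goncarov_def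
proof (rule the_equality)
  let ?V = "span (goncarov_poly D (\<lambda>k. 0) ` {k. k \<le> n})"
  have V: "delta_space D n = ?V"
    by (simp add: delta_space_def basic_sequence_eq)
  let ?c = "\<lambda>k. delta_power D k (goncarov_poly D z n) 0 / mi_fact k"
  have "?c k *\<^sub>R goncarov_poly D (\<lambda>k. 0) k \<in> ?V" for k
  proof (cases "k \<le> n")
    case True
    then show ?thesis by (intro span_scale span_base) simp
  next
    case False
    then show ?thesis by (simp add: delta_power_goncarov_eq_0 span_zero)
  qed
  then have "goncarov_poly D z n \<in> ?V"
    by (subst goncarov_expansion[OF goncarov_degree, of z n "\<lambda>k. 0"]) (rule span_sum)
  then show "goncarov_poly D z n \<in> delta_space D n \<and>
      (\<forall>k\<le>n. delta_power D k (goncarov_poly D z n) (z k) = (if k = n then mi_fact n else 0))"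
    using goncarov_eval V by simp
  fix t assume t: "t \<in> delta_space D n \<and>
      (\<forall>k\<le>n. delta_power D k t (z k) = (if k = n then mi_fact n else 0))"
  obtain c where c: "t = (\<Sum>k | k \<le> n. c k *\<^sub>R goncarov_poly D (\<lambda>k. 0) k)"
  proof -
    \<comment> \<open>The span provides coefficients indexed by polynomials; injectivity turns them
      into coefficients indexed by multi-indices.\<close>
    have inj: "inj_on (goncarov_poly D (\<lambda>k. 0)) {k. k \<le> n}"
    proof (rule inj_onI)
      fix k l assume eq: "goncarov_poly D (\<lambda>k. 0) k = goncarov_poly D (\<lambda>k. 0) l"
      have "(if k = l then mi_fact l else 0) = delta_power D k (goncarov_poly D (\<lambda>k. 0) k) 0"
        unfolding eq by (rule goncarov_eval[symmetric])
      also have "\<dots> = mi_fact k"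
        using goncarov_eval[of k "\<lambda>k. 0" k] by simp
      finally show "k = l"
        using mi_fact_pos[of k] by (metis less_irrefl)
    qed
    from t V obtain u where "t = (\<Sum>v\<in>goncarov_poly D (\<lambda>k. 0) ` {k. k \<le> n}. u v *\<^sub>R v)"
      by (auto simp: span_finite finite_mi_le)
    then show thesis
      using that[of "\<lambda>k. u (goncarov_poly D (\<lambda>k. 0) k)"]
      by (simp only: sum.reindex[OF inj] o_def)
  qed
  have polys: "t \<in> polys"
    unfolding c by (intro polys_closure goncarov_in_polys)
  have "delta_power D k t (z k) = 0" if "\<not> k \<le> n" for k
    unfolding c
  proof (subst delta_power_sum[OF D goncarov_in_polys], intro sum.neutral ballI)
    fix j assume "j \<in> {k. k \<le> n}"
    with that have "\<not> k \<le> j" using order.trans[of k j n] by blast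
    then show "c j * delta_power D k (goncarov_poly D (\<lambda>k. 0) j) (z k) = 0"
      by (simp add: delta_power_goncarov_eq_0)
  qed
  with t have "delta_power D k t (z k) = (if k = n then mi_fact n else 0)" for k
    by (cases "k \<le> n") auto
  from goncarov_unique[OF polys this] show "t = goncarov_poly D z n" ..
qed

section \<open>Binomial type and additive grids\<close>

lemma goncarov_separates_points:
  assumes "\<And>i. goncarov_poly D z (axis i 1) x = goncarov_poly D z (axis i 1) y"
  shows "x = y"
proof -
  \<comment> \<open>The polynomials of index 0 and of the unit multi-indices span all affine
    functions, among them the coordinates.\<close>
  have eq: "f x = f y" if "f \<in> degree_less 2" for f
  proof -
    have "goncarov_poly D z k x = goncarov_poly D z k y" if "mi_size k < 2" for k
    proof -
      from that consider "mi_size k = 0" | "mi_size k = 1" by linarith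
      then show ?thesis
      proof cases
        case 1
        then show ?thesis by (simp add: mi_size_eq_0_iff goncarov_0)
      next
        case 2
        then obtain i where "k = axis i 1" using mi_size_1_iff[of k] by blast
        then show ?thesis by (simp only: assms)
      qed
    qed
    then show ?thesis
      by (subst (1 2) goncarov_expansion[OF that, of z])
         (auto simp: sum_fun_apply scaleR_fun_def intro!: sum.cong)
  qed
  have "x $ i = y $ i" for i
  proof -
    have "monomial (axis i 1) \<in> degree_less 2"
      unfolding degree_less_def by (rule span_base) (auto simp: mi_size_axis)
    from eq[OF this] show ?thesis by (simp only: monomial_axis)
  qed
  then show ?thesis by (simp add: vec_eq_iff)
qed

text \<open>
  Apply the functional \<open>f \<mapsto> (D\<^sup>k f) (z k)\<close> to both sides of the binomial identity as functions of
  \<open>x\<close>: on the right it picks out the \<open>k\<close>-th summand.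
\<close>

lemma goncarov_binomial_shift:
  assumes "k \<le> n"
    and "\<And>x y. goncarov_poly D z n (x + y) =
      (\<Sum>k | k \<le> n. real (mi_choose n k) * goncarov_poly D z k x * goncarov_poly D z (n - k) y)"
  shows "shift (z k) (delta_power D k (goncarov_poly D z n)) =
    (mi_fact n / mi_fact (n - k)) *\<^sub>R goncarov_poly D z (n - k)"
proof
  fix y
  let ?t = "goncarov_poly D z"
  have "shift y (?t n) = (\<Sum>j | j \<le> n. (real (mi_choose n j) * ?t (n - j) y) *\<^sub>R ?t j)"
    by (auto simp: fun_eq_iff shift_def assms(2) sum_fun_apply scaleR_fun_def intro!: sum.cong)
  then have "delta_power D k (shift y (?t n)) (z k) =
      (\<Sum>j | j \<le> n. real (mi_choose n j) * ?t (n - j) y * delta_power D k (?t j) (z k))"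
    by (simp add: delta_power_sum[OF D goncarov_in_polys])
  also have "\<dots> = (\<Sum>j | j \<le> n. if j = k then real (mi_choose n k) * ?t (n - k) y * mi_fact k else 0)"
    by (intro sum.cong) (auto simp: goncarov_eval)
  also have "\<dots> = real (mi_choose n k) * mi_fact k * ?t (n - k) y"
    using assms(1) by (simp add: sum.delta finite_mi_le)
  also have "\<dots> = mi_fact n / mi_fact (n - k) * ?t (n - k) y"
    using mi_choose_fact[OF assms(1)] mi_fact_pos[of "n - k"] by (simp add: field_simps)
  finally have "delta_power D k (shift y (?t n)) (z k) = mi_fact n / mi_fact (n - k) * ?t (n - k) y" .
  then show "shift (z k) (delta_power D k (?t n)) y =
      ((mi_fact n / mi_fact (n - k)) *\<^sub>R ?t (n - k)) y"
    unfolding op_shift[OF delta_power_op[OF D] goncarov_in_polys]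
    by (simp add: shift_def scaleR_fun_def add.commute)
qed

lemma binomial_imp_additive:
  assumes "binomial_type (goncarov_poly D z)"
  shows "z (k + l) = z k + z l"
proof -
  let ?t = "goncarov_poly D z"
  note shift = goncarov_binomial_shift[of _ _ z, OF _ assms[unfolded binomial_type_def,
        THEN conjunct2, THEN conjunct2, rule_format]]
  \<comment> \<open>The defect of additivity, to be identified with 0 by separation of
    points.\<close>
  define w where "w = z k + z l - z (k + l)"
  have "?t (axis i 1) w = ?t (axis i 1) 0" for i
  proof -
    define e :: "(nat, 'd) vec" where "e = axis i 1"
    \<comment> \<open>Chosen so that removing \<open>k\<close> and \<open>l\<close> leaves exactly
      the unit index \<open>e\<close>.\<close>
    define n where "n = k + l + e"
    have le: "l \<le> n" "k \<le> n - l" "k + l \<le> n"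
      and diff: "n - l - k = e" "n - (k + l) = e"
      by (auto simp: n_def less_eq_vec_def vec_eq_iff)
    let ?g = "delta_power D (k + l) (?t n)"
    have g: "?g \<in> polys" by (rule op_polys[OF delta_power_op[OF D] goncarov_in_polys])
    have "shift (z k + z l) ?g = shift (z k) (shift (z l) (delta_power D k (delta_power D l (?t n))))"
      by (simp only: shift_shift delta_power_add[OF D goncarov_in_polys])
    also have "\<dots> = shift (z k) (delta_power D k (shift (z l) (delta_power D l (?t n))))"
      by (simp only: op_shift[OF delta_power_op[OF D] op_polys[OF delta_power_op[OF D] goncarov_in_polys]])
    also have "\<dots> = shift (z k) (delta_power D k ((mi_fact n / mi_fact (n - l)) *\<^sub>R ?t (n - l)))"
      by (simp only: shift[OF le(1)])
    also have "\<dots> = (mi_fact n / mi_fact (n - l)) *\<^sub>R shift (z k) (delta_power D k (?t (n - l)))"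
      unfolding op_scaleR[OF delta_power_op[OF D] goncarov_in_polys]
      by (simp add: shift_def scaleR_fun_def)
    also have "\<dots> = (mi_fact n / mi_fact e) *\<^sub>R ?t e"
      using mi_fact_pos[of "n - l"] by (simp add: shift[OF le(2)] diff)
    also have "\<dots> = shift (z (k + l)) ?g"
      by (simp only: shift[OF le(3)] diff)
    finally have "shift (z k + z l) ?g 0 = (mi_fact n / mi_fact e) * ?t e 0"
      by (simp only: shift[OF le(3)] diff scaleR_fun_def real_scaleR_def)
    moreover have "shift (z (k + l)) ?g w = (mi_fact n / mi_fact e) * ?t e w"
      by (simp only: shift[OF le(3)] diff scaleR_fun_def real_scaleR_def)
    \<comment> \<open>Both sides evaluate \<open>?g\<close> at the point
      \<open>z k + z l = w + z (k + l)\<close>.\<close>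
    moreover have "shift (z k + z l) ?g 0 = shift (z (k + l)) ?g w"
      by (simp add: shift_def w_def)
    ultimately have "?t e w = ?t e 0"
      using mi_fact_pos[of n] mi_fact_pos[of e] by simp
    then show ?thesis by (simp only: e_def)
  qed
  from goncarov_separates_points[OF this] show ?thesis
    by (simp add: w_def)
qed

text \<open>Delta powers commute with shifts, so conditions at \<open>z k + v\<close> on a
  polynomial become conditions at \<open>z k\<close> on its shift.\<close>

lemma goncarov_shift: "shift v (goncarov_poly D (\<lambda>k. z k + v) n) = goncarov_poly D z n"
proof (rule goncarov_unique[symmetric])
  show "shift v (goncarov_poly D (\<lambda>k. z k + v) n) \<in> polys"
    by (rule shift_polys[OF goncarov_in_polys])
  show "delta_power D k (shift v (goncarov_poly D (\<lambda>k. z k + v) n)) (z k) =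
      (if k = n then mi_fact n else 0)" for k
    unfolding op_shift[OF delta_power_op[OF D] goncarov_in_polys]
    using goncarov_eval[of k "\<lambda>k. z k + v" n] by (simp add: shift_def)
qed

lemma additive_imp_binomial:
  assumes add: "\<And>k l. z (k + l) = z k + z l"
  shows "binomial_type (goncarov_poly D z)"
proof -
  let ?t = "goncarov_poly D z"
  have size_le_1: "{k :: (nat, 'd) vec. mi_size k < 2} = insert 0 (range (\<lambda>i. axis i 1))"
    using mi_size_1_iff by (auto simp: less_2_cases_iff mi_size_eq_0_iff)
  have "insert (?t 0) (range (\<lambda>i. ?t (axis i 1))) = ?t ` {k. mi_size k < 2}"
    unfolding size_le_1 by auto
  then have "span (insert (?t 0) (range (\<lambda>i. ?t (axis i 1)))) = span (monomial ` {k. mi_size k \<le> 1})"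
    using degree_less_eq_span_goncarov[of 2 z] by (simp add: degree_less_def less_2_cases_iff le_Suc_eq)
  moreover have "?t n (x + y) = (\<Sum>k | k \<le> n. real (mi_choose n k) * ?t k x * ?t (n - k) y)"
    for n x y
  proof -
    let ?f = "\<Sum>k | k \<le> n. (real (mi_choose n k) * ?t (n - k) y) *\<^sub>R ?t k"
    \<comment> \<open>For fixed \<open>y\<close> the binomial identity is an equality of polynomials
      in \<open>x\<close>, which can be tested by the interpolation functionals of the grid
      \<open>z\<close>.\<close>
    have "shift y (?t n) = ?f"
    proof (rule delta_eqI[OF D, of _ _ z])
      show "shift y (?t n) \<in> polys" by (rule shift_polys[OF goncarov_in_polys])
      show "?f \<in> polys" by (intro polys_closure goncarov_in_polys)
      fix k
      have "delta_power D k ?f (z k) =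
          (\<Sum>j | j \<le> n. real (mi_choose n j) * ?t (n - j) y * delta_power D k (?t j) (z k))"
        by (simp add: delta_power_sum[OF D goncarov_in_polys])
      also have "\<dots> = (\<Sum>j | j \<le> n. if j = k then real (mi_choose n k) * ?t (n - k) y * mi_fact k else 0)"
        by (intro sum.cong) (auto simp: goncarov_eval)
      also have "\<dots> = (if k \<le> n then real (mi_choose n k) * mi_fact k * ?t (n - k) y else 0)"
        by (simp add: sum.delta finite_mi_le)
      also have "\<dots> = shift (z k) (delta_power D k (?t n)) y"
      proof (cases "k \<le> n")
        case True
        \<comment> \<open>Additivity makes the grid \<open>l \<mapsto> z (l + k)\<close> the
          translate of \<open>z\<close> by \<open>z k\<close>, which the shift then undoes.\<close>
        have "shift (z k) (delta_power D k (?t n)) y =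
            (mi_fact n / mi_fact (n - k)) *
            shift (z k) (goncarov_poly D (\<lambda>l. z l + z k) (n - k)) y"
          unfolding delta_power_goncarov[OF True] add by (simp add: shift_def scaleR_fun_def)
        then have "shift (z k) (delta_power D k (?t n)) y = (mi_fact n / mi_fact (n - k)) * ?t (n - k) y"
          by (simp only: goncarov_shift)
        moreover have "real (mi_choose n k) * mi_fact k = mi_fact n / mi_fact (n - k)"
          using mi_choose_fact[OF True] by (simp add: field_simps)
        ultimately show ?thesis
          using True by simp
      next
        case False
        then show ?thesis by (simp add: delta_power_goncarov_eq_0 shift_def)
      qed
      also have "\<dots> = delta_power D k (shift y (?t n)) (z k)"
        unfolding op_shift[OF delta_power_op[OF D] goncarov_in_polys]
        by (simp add: shift_def add.commute)
      finally show "delta_power D k (shift y (?t n)) (z k) = delta_power D k ?f (z k)" ..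
    qed
    then have "shift y (?t n) x = ?f x" by (rule fun_cong)
    then show ?thesis
      by (simp add: shift_def sum_fun_apply scaleR_fun_def algebra_simps)
  qed
  ultimately show ?thesis
    unfolding binomial_type_def using goncarov_has_degree by blast
qed

end

section \<open>Additive maps on multi-indices as matrices\<close>

lemma additive_multi_index_iff_matrix:
  fixes z :: "nat ^ 'd::finite \<Rightarrow> real ^ 'e::finite"
  shows "(\<forall>k l. z (k + l) = z k + z l) \<longleftrightarrow>
    (\<exists>A :: real ^ 'd ^ 'e. \<forall>k. z k = A *v (\<chi> i. real (k $ i)))"
proof
  assume additive: "\<forall>k l. z (k + l) = z k + z l"
  \<comment> \<open>The columns are the values of \<open>z\<close> at the unit
    multi-indices.\<close>
  define A :: "real ^ 'd ^ 'e" where "A = (\<chi> r i. z (axis i 1) $ r)"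
  have "z k = A *v (\<chi> i. real (k $ i))" for k
  proof (induction k rule: mi_induct)
    case zero
    have "z 0 = 0" using additive[rule_format, of 0 0] by simp
    then show ?case by (simp add: matrix_vector_mult_def vec_eq_iff)
  next
    case (add k i)
    have eq: "(\<chi> j. real ((k + axis i 1) $ j)) = (\<chi> j. real (k $ j)) + axis i 1"
      by (simp add: vec_eq_iff axis_def)
    have "A *v axis i 1 = z (axis i 1)"
      by (simp add: vec_eq_iff A_def matrix_vector_mult_def axis_def if_distrib cong: if_cong)
    then show ?case
      unfolding eq matrix_vector_right_distrib using add additive by simp
  qed
  then show "\<exists>A :: real ^ 'd ^ 'e. \<forall>k. z k = A *v (\<chi> i. real (k $ i))" by blast
next
  assume "\<exists>A :: real ^ 'd ^ 'e. \<forall>k. z k = A *v (\<chi> i. real (k $ i))"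
  then show "\<forall>k l. z (k + l) = z k + z l"
    by (auto simp: matrix_vector_mult_def vec_eq_iff ring_distribs sum.distrib)
qed

theorem theorem5:
  fixes D :: "'d::{finite,linorder} \<Rightarrow> ((real, 'd) vec \<Rightarrow> real) \<Rightarrow> ((real, 'd) vec \<Rightarrow> real)"
    and z :: "(nat, 'd) vec \<Rightarrow> (real, 'd) vec"
  assumes "delta_system D"
  shows "binomial_type (delta_goncarov D z) \<longleftrightarrow>
         (\<exists>A :: ((real, 'd) vec, 'd) vec. \<forall>k. z k = A *v (\<chi> i. real (k $ i)))"
proof -
  have "delta_goncarov D z = goncarov_poly D z"
    by (rule ext) (rule delta_goncarov_eq[OF assms])
  then show ?thesis
    unfolding additive_multi_index_iff_matrix[symmetric]
    using binomial_imp_additive[OF assms] additive_imp_binomial[OF assms] by metis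
qed

end
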